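(* Let $(X,\lVert\cdot\rVert_X)$ be a quasi-Banach function space over $(R,\mu)$ and denote by $C$ the modulus of concavity of $\lVert\cdot\rVert_X$. Then $X$ has the generalised Riesz--Fischer property with constant $C$. Furthermore, let $(f_n)_{n\in\mathbb N}$ be a sequence in $X$ such that $$\sum_{n=0}^\infty C^{n+1}\lVert f_n\rVert_X<\infty$$ and put $f=\sum_{n=0}^\infty f_n$, where the series converges in $X$. Then also $f=\sum_{n=0}^\infty f_n$ $\mu$-a.e. (pointwise convergence $\mu$-a.e. of the partial sums to $f$).
   Context: Here $0\in\mathbb N$ and $(R,\mu)$ is a $\sigma$-finite measure space. $M=M(R,\mu)$ is the set of all $\mu$-measurable functions $R\to\mathbb C\cup\{\infty\}$, functions equal $\mu$-a.e. being identified; $M_+$ is the subset of functions with values in $[0,\infty]$. A quasi-Banach function norm is a map $\lVert\cdot\rVert:M\to[0,\infty]$ with $\lVert\,|f|\,\rVert=\lVert f\rVert$ for all $f\in M$ whose restriction to $M_+$ satisfies: (Q1) (a) $\lVert af\rVert=|a|\lVert f\rVert$ for all $a\in\mathbb C$, $f\in M_+$ (with the usual convention $0\cdot\infty=0$); (b) $\lVert f\rVert=0$ iff $f=0$ $\mu$-a.e.; (c) there is a constant $C\ge1$, called the modulus of concavity of $\lVert\cdot\rVert$, such that $\lVert f+g\rVert\le C(\lVert f\rVert+\lVert g\rVert)$ for all $f,g\in M_+$; (P2) if $f,g\in M_+$ and $f\le g$ $\mu$-a.e., then $\lVert f\rVert\le\lVert g\rVert$; (P3) if $f_n,f\in M_+$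 and $f_n\uparrow f$ $\mu$-a.e., then $\lVert f_n\rVert\uparrow\lVert f\rVert$; (P4) $\lVert\chi_E\rVert<\infty$ for every measurable $E\subseteq R$ with $\mu(E)<\infty$. The corresponding quasi-Banach function space is $X=\{f\in M:\lVert f\rVert_X<\infty\}$ with the quasinorm $\lVert\cdot\rVert_X$; $f_n\to f$ in $X$ means $\lVert f_n-f\rVert_X\to0$. For $C\in[1,\infty)$, $X$ has the generalised Riesz--Fischer property with constant $C$ if for every sequence $(x_n)_{n\in\mathbb N}$ in $X$ with $\sum_{n=0}^\infty C^{n+1}\lVert x_n\rVert_X<\infty$ there is $x\in X$ such that $\sum_{n=0}^N x_n\to x$ in $X$ as $N\to\infty$. *)

theory Defs
  imports "HOL-Analysis.Analysis"
begin

datatype ecomplex = Cfin complex | Cinf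

text \<open>Sums involving \<open>Cinf\<close> are set to \<open>Cinf\<close>. This is the usual convention on \<open>[0, \<infinity>]\<close>; the
  remaining cases, and differences, only matter on null sets, since elements of the function
  spaces below are finite almost everywhere.\<close>

instantiation ecomplex :: comm_monoid_add
begin

definition zero_ecomplex :: ecomplex where
  "zero_ecomplex = Cfin 0"

fun plus_ecomplex :: "ecomplex \<Rightarrow> ecomplex \<Rightarrow> ecomplex" where
  "Cfin a + Cfin b = Cfin (a + b)"
| "Cinf + b = Cinf"
| "a + Cinf = Cinf"

instance
proof
  fix a b c :: ecomplex
  show "a + b + c = a + (b + c)"
    by (cases a; cases b; cases c) (simp_all add: add.assoc)
  show "a + b = b + a"
    by (cases a; cases b) (simp_all add: add.commute)
  show "0 + a = a"
    by (cases a) (simp_all add: zero_ecomplex_def)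
qed

end

instantiation ecomplex :: minus
begin

fun minus_ecomplex :: "ecomplex \<Rightarrow> ecomplex \<Rightarrow> ecomplex" where
  "Cfin a - Cfin b = Cfin (a - b)"
| "Cinf - b = Cinf"
| "a - Cinf = Cinf"

instance ..

end

fun ecomplex_scale :: "complex \<Rightarrow> ecomplex \<Rightarrow> ecomplex" where
  "ecomplex_scale a (Cfin z) = Cfin (a * z)"
| "ecomplex_scale a Cinf = (if a = 0 then 0 else Cinf)"

fun ecomplex_abs :: "ecomplex \<Rightarrow> ennreal" where
  "ecomplex_abs (Cfin z) = ennreal (cmod z)"
| "ecomplex_abs Cinf = \<infinity>"

definition ecomplex_of_ennreal :: "ennreal \<Rightarrow> ecomplex" where
  "ecomplex_of_ennreal t = (if t = \<infinity> then Cinf else Cfin (complex_of_real (enn2real t)))"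

text \<open>The topology of the one-point compactification of the complex plane.\<close>

instantiation ecomplex :: topological_space
begin

definition open_ecomplex :: "ecomplex set \<Rightarrow> bool" where
  "open_ecomplex U \<longleftrightarrow> open (Cfin -` U) \<and> (Cinf \<in> U \<longrightarrow> compact (- (Cfin -` U)))"

instance
proof
  show "open (UNIV :: ecomplex set)"
    by (simp add: open_ecomplex_def)
next
  fix S T :: "ecomplex set"
  assume "open S" "open T"
  then show "open (S \<inter> T)"
    by (auto simp: open_ecomplex_def vimage_Int Compl_Int)
next
  fix K :: "ecomplex set set"
  assume K: "\<forall>S\<in>K. open S"
  have op: "open (Cfin -` \<Union>K)"
    using K by (auto simp: open_ecomplex_def vimage_Union)
  moreover have "compact (- (Cfin -` \<Union>K))" if inf: "Cinf \<in> \<Union>K"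
  proof -
    obtain S where S: "S \<in> K" "Cinf \<in> S"
      using inf by blast
    then have "compact (- (Cfin -` S))"
      using K by (simp add: open_ecomplex_def)
    moreover have "closed (- (Cfin -` \<Union>K))"
      using op by (simp add: closed_def)
    moreover have "- (Cfin -` \<Union>K) = - (Cfin -` S) \<inter> - (Cfin -` \<Union>K)"
      using S by blast
    ultimately show ?thesis
      by (metis compact_Int_closed)
  qed
  ultimately show "open (\<Union>K)"
    by (simp add: open_ecomplex_def)
qed

end

text \<open>Functions that agree almost everywhere are identified by requiring the norm not to
  distinguish them (\<open>norm_cong_AE\<close>). Functions with values in \<open>[0, \<infinity>]\<close> are given as
  \<^typ>\<open>ennreal\<close>-valued functions and embedded by \<^const>\<open>ecomplex_of_ennreal\<close>. The parameter \<open>C\<close>,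
  the modulus of concavity, is any constant for which \<open>norm_triangle\<close> holds, not necessarily
  the least one. The norm is unconstrained on non-measurable functions.\<close>

locale quasi_banach_function_norm = sigma_finite_measure M
  for M :: "'a measure" +
  fixes N :: "('a \<Rightarrow> ecomplex) \<Rightarrow> ennreal" and C :: real
  assumes norm_cong_AE:
      "\<And>f g. f \<in> borel_measurable M \<Longrightarrow> g \<in> borel_measurable M \<Longrightarrow> (AE x in M. f x = g x) \<Longrightarrow>
        N f = N g"
    and norm_abs:
      "\<And>f. f \<in> borel_measurable M \<Longrightarrow>
        N (\<lambda>x. ecomplex_of_ennreal (ecomplex_abs (f x))) = N f"
    and norm_scale:
      "\<And>a f. f \<in> borel_measurable M \<Longrightarrow>
        N (\<lambda>x. ecomplex_scale a (ecomplex_of_ennreal (f x))) =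
        ennreal (cmod a) * N (\<lambda>x. ecomplex_of_ennreal (f x))"
    and norm_eq_0_iff:
      "\<And>f. f \<in> borel_measurable M \<Longrightarrow>
        N (\<lambda>x. ecomplex_of_ennreal (f x)) = 0 \<longleftrightarrow> (AE x in M. f x = 0)"
    and concavity_ge_1: "1 \<le> C"
    and norm_triangle:
      "\<And>f g. f \<in> borel_measurable M \<Longrightarrow> g \<in> borel_measurable M \<Longrightarrow>
        N (\<lambda>x. ecomplex_of_ennreal (f x + g x)) \<le>
        ennreal C * (N (\<lambda>x. ecomplex_of_ennreal (f x)) + N (\<lambda>x. ecomplex_of_ennreal (g x)))"
    and norm_mono:
      "\<And>f g. f \<in> borel_measurable M \<Longrightarrow> g \<in> borel_measurable M \<Longrightarrow> (AE x in M. f x \<le> g x) \<Longrightarrow>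
        N (\<lambda>x. ecomplex_of_ennreal (f x)) \<le> N (\<lambda>x. ecomplex_of_ennreal (g x))"
    and norm_Fatou:
      "\<And>f g. (\<And>n. f n \<in> borel_measurable M) \<Longrightarrow> g \<in> borel_measurable M \<Longrightarrow>
        (AE x in M. incseq (\<lambda>n::nat. f n x) \<and> (\<lambda>n. f n x) \<longlonglongrightarrow> g x) \<Longrightarrow>
        incseq (\<lambda>n. N (\<lambda>x. ecomplex_of_ennreal (f n x))) \<and>
        (\<lambda>n. N (\<lambda>x. ecomplex_of_ennreal (f n x))) \<longlonglongrightarrow> N (\<lambda>x. ecomplex_of_ennreal (g x))"
    and norm_indicator:
      "\<And>E. E \<in> sets M \<Longrightarrow> emeasure M E < \<infinity> \<Longrightarrow>
        N (\<lambda>x. ecomplex_of_ennreal (indicator E x)) < \<infinity>"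

definition function_space :: "'a measure \<Rightarrow> (('a \<Rightarrow> ecomplex) \<Rightarrow> ennreal) \<Rightarrow> ('a \<Rightarrow> ecomplex) set" where
  "function_space M N = {f \<in> borel_measurable M. N f < \<infinity>}"

definition norm_tendsto ::
    "(('a \<Rightarrow> ecomplex) \<Rightarrow> ennreal) \<Rightarrow> (nat \<Rightarrow> 'a \<Rightarrow> ecomplex) \<Rightarrow> ('a \<Rightarrow> ecomplex) \<Rightarrow> bool" where
  "norm_tendsto N s f \<longleftrightarrow> (\<lambda>k. N (\<lambda>x. s k x - f x)) \<longlonglongrightarrow> 0"

definition generalised_riesz_fischer ::
    "'a measure \<Rightarrow> (('a \<Rightarrow> ecomplex) \<Rightarrow> ennreal) \<Rightarrow> real \<Rightarrow> bool" where
  "generalised_riesz_fischer M N C \<longleftrightarrow>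
    (\<forall>f :: nat \<Rightarrow> 'a \<Rightarrow> ecomplex.
      (\<forall>n. f n \<in> function_space M N) \<and> (\<Sum>n. ennreal (C ^ (n + 1)) * N (f n)) < \<infinity> \<longrightarrow>
      (\<exists>g \<in> function_space M N. norm_tendsto N (\<lambda>k x. \<Sum>n\<le>k. f n x) g))"

end

theory Submission
  imports Defs
begin

text \<open>Iterating the quasi-triangle inequality gives
  \<open>\<parallel>\<Sum>n<k. h n\<parallel> \<le> (\<Sum>n<k. C^(n+1) * \<parallel>h n\<parallel>)\<close> for nonnegative \<open>h n\<close>, and the Fatou property
  extends this to infinite sums. Applied to \<open>h n = \<bar>f n\<bar>\<close> it shows that \<open>\<Sum>n. \<bar>f n\<bar>\<close> has finite
  norm, hence is finite almost everywhere, so that \<open>\<Sum>n. f n\<close> converges absolutely almost everywhere.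
  Applied to the tails of the series it shows that the pointwise sum is also the limit in norm.
  Limits in norm are unique up to null sets.\<close>

section \<open>Algebra and topology of the extended complex plane\<close>

text \<open>Brings series back to \<open>complex\<close>, where summability is available. The value
  at \<open>Cinf\<close> is a mere default: it is met only on null sets or under an explicit case
  distinction.\<close>

fun finite_part :: "ecomplex \<Rightarrow> complex" where
  "finite_part (Cfin z) = z"
| "finite_part Cinf = 0"

lemma ecomplex_abs_eq_top_iff [simp]: "ecomplex_abs z = top \<longleftrightarrow> z = Cinf"
  by (cases z) auto

lemma Cfin_finite_part: "z \<noteq> Cinf \<Longrightarrow> Cfin (finite_part z) = z"
  by (cases z) auto

lemma ecomplex_abs_diff_le:
  assumes "s \<noteq> Cinf" "a \<noteq> Cinf" "b \<noteq> Cinf"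
  shows "ecomplex_abs (a - b) \<le> ecomplex_abs (s - a) + ecomplex_abs (s - b)"
proof -
  obtain s' a' b' where *: "s = Cfin s'" "a = Cfin a'" "b = Cfin b'"
    using assms by (metis Cfin_finite_part)
  have "cmod (a' - b') \<le> cmod (s' - a') + cmod (s' - b')"
    using norm_triangle_ineq4[of "s' - b'" "s' - a'"] by (simp add: algebra_simps)
  then show ?thesis
    by (simp add: * flip: ennreal_plus)
qed

lemma sum_Cfin: "(\<Sum>n\<in>A. Cfin (z n)) = Cfin (\<Sum>n\<in>A. z n)"
  by (induction A rule: infinite_finite_induct) (simp_all add: zero_ecomplex_def)

lemma continuous_on_Cfin: "continuous_on UNIV Cfin"
  by (auto simp: continuous_on_open_vimage open_ecomplex_def)

lemma sums_Cfin:
  assumes "z sums s"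
  shows "(\<lambda>n. Cfin (z n)) sums Cfin s"
proof -
  have "isCont Cfin s"
    using continuous_on_Cfin by (simp add: continuous_on_eq_continuous_at)
  then show ?thesis
    using assms by (auto simp: sums_def sum_Cfin intro: isCont_tendsto_compose)
qed

section \<open>Measurability of the operations on \<open>ecomplex\<close>\<close>

lemma measurable_Cfin [measurable]: "Cfin \<in> borel_measurable borel"
  by (intro borel_measurable_continuous_onI continuous_on_Cfin)

text \<open>\<open>Cinf\<close> lies outside the image, so the compactness clause for open sets is
  vacuous.\<close>

lemma open_image_Cfin: "open U \<Longrightarrow> open (Cfin ` U)"
  by (auto simp: open_ecomplex_def inj_vimage_image_eq inj_def)

lemma sets_Cinf [measurable]: "{Cinf} \<in> sets borel"
proof -
  have "z \<in> - range Cfin \<longleftrightarrow> z \<in> {Cinf}" for z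
    by (cases z) auto
  then have "- range Cfin = {Cinf}"
    by blast
  then show ?thesis
    by (metis borel_comp borel_open open_UNIV open_image_Cfin)
qed

lemma pred_eq_Cinf [measurable]:
  assumes [measurable]: "f \<in> borel_measurable M"
  shows "Measurable.pred M (\<lambda>x. f x = Cinf)"
proof -
  have "Measurable.pred M (\<lambda>x. f x \<in> {Cinf})"
    by measurable
  then show ?thesis
    by simp
qed

lemma measurable_finite_part [measurable]: "finite_part \<in> borel_measurable borel"
proof (rule borel_measurableI)
  fix U :: "complex set"
  assume "open U"
  \<comment> \<open>The preimage gains the point \<open>Cinf\<close> exactly when \<open>U\<close>
    contains the default value \<open>0\<close>.\<close>
  have "finite_part z \<in> U \<longleftrightarrow> z \<in> Cfin ` U \<union> (if 0 \<in> U then {Cinf} else {})" for z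
    by (cases z) auto
  then have "finite_part -` U \<inter> space borel = Cfin ` U \<union> (if 0 \<in> U then {Cinf} else {})"
    by auto
  moreover have "Cfin ` U \<in> sets borel"
    by (intro borel_open open_image_Cfin \<open>open U\<close>)
  ultimately show "finite_part -` U \<inter> space borel \<in> sets borel"
    using sets_Cinf by (simp only: sets.Un sets.empty_sets split: if_split) blast
qed

lemma measurable_ecomplex_abs [measurable]: "ecomplex_abs \<in> borel_measurable borel"
proof -
  have "ecomplex_abs z = (if z = Cinf then \<infinity> else ennreal (cmod (finite_part z)))" for z
    by (cases z) auto
  then show ?thesis
    by (subst measurable_cong) (assumption, measurable)
qed

lemma measurable_ecomplex_of_ennreal [measurable]: "ecomplex_of_ennreal \<in> borel_measurable borel"
  unfolding ecomplex_of_ennreal_def [abs_def] by measurable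

lemma measurable_ecomplex_plus [measurable]:
  fixes f g :: "'a \<Rightarrow> ecomplex"
  assumes [measurable]: "f \<in> borel_measurable M" "g \<in> borel_measurable M"
  shows "(\<lambda>x. f x + g x) \<in> borel_measurable M"
proof -
  have "a + b = (if a = Cinf \<or> b = Cinf then Cinf else Cfin (finite_part a + finite_part b))" for a b
    by (cases a; cases b) auto
  then show ?thesis
    by simp
qed

lemma measurable_ecomplex_minus [measurable]:
  fixes f g :: "'a \<Rightarrow> ecomplex"
  assumes [measurable]: "f \<in> borel_measurable M" "g \<in> borel_measurable M"
  shows "(\<lambda>x. f x - g x) \<in> borel_measurable M"
proof -
  have "a - b = (if a = Cinf \<or> b = Cinf then Cinf else Cfin (finite_part a - finite_part b))" for a b
    by (cases a; cases b) auto
  then show ?thesis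
    by simp
qed

lemma measurable_ecomplex_sum [measurable]:
  fixes f :: "'i \<Rightarrow> 'a \<Rightarrow> ecomplex"
  assumes [measurable]: "\<And>i. i \<in> I \<Longrightarrow> f i \<in> borel_measurable M"
  shows "(\<lambda>x. \<Sum>i\<in>I. f i x) \<in> borel_measurable M"
  using assms by (induction I rule: infinite_finite_induct) simp_all

section \<open>Tails of convergent series in \<open>ennreal\<close>\<close>

lemma tendsto_suminf_tail_ennreal:
  fixes a :: "nat \<Rightarrow> ennreal"
  assumes "(\<Sum>n. a n) < \<infinity>"
  shows "(\<lambda>k. \<Sum>n. a (n + k)) \<longlonglongrightarrow> 0"
proof -
  have fin: "a n \<noteq> top" for n
    using assms ennreal_suminf_lessD[of a top n] by simp
  \<comment> \<open>All terms are finite, so the claim reduces to the tails of a summable real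
    series.\<close>
  define b where "b n = enn2real (a n)" for n
  have ab: "a = (\<lambda>n. ennreal (b n))" and b0: "\<And>n. 0 \<le> b n"
    using fin by (auto simp: b_def less_top)
  have "summable b"
    using assms b0 by (intro summable_suminf_not_top) (simp_all add: ab)
  then have "(\<lambda>k. ennreal (\<Sum>n. b (n + k))) \<longlonglongrightarrow> ennreal 0"
    using suminf_exist_split2 by (intro tendsto_ennrealI) blast
  moreover have "ennreal (\<Sum>n. b (n + k)) = (\<Sum>n. a (n + k))" for k
    using \<open>summable b\<close> b0 by (simp add: ab suminf_ennreal2 summable_ignore_initial_segment)
  ultimately show ?thesis
    by simp
qed

section \<open>Consequences of the quasinorm axioms\<close>

context quasi_banach_function_norm
begin

abbreviation L :: "('a \<Rightarrow> ennreal) \<Rightarrow> ennreal" where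
  "L h \<equiv> N (\<lambda>x. ecomplex_of_ennreal (h x))"

text \<open>Splitting off the first term costs one factor \<open>C\<close> on that term and on the
  whole remaining sum, so \<open>h n\<close> collects \<open>C ^ (n + 1)\<close>. Splitting off the
  last term would put the highest powers on the first terms. The remaining sum belongs to the
  shifted sequence, hence the induction over arbitrary \<open>h\<close>.\<close>

lemma norm_sum_le:
  assumes "\<And>n. h n \<in> borel_measurable M"
  shows "L (\<lambda>x. \<Sum>n<k. h n x) \<le> (\<Sum>n<k. ennreal (C ^ (n + 1)) * L (h n))"
  using assms
proof (induction k arbitrary: h)
  case 0
  show ?case
    using norm_eq_0_iff[of "\<lambda>x. 0"] by simp
next
  case (Suc k)
  note [measurable] = Suc.prems
  have "L (\<lambda>x. \<Sum>n<Suc k. h n x) = L (\<lambda>x. h 0 x + (\<Sum>n<k. h (Suc n) x))"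
    by (simp only: sum.lessThan_Suc_shift)
  also have "\<dots> \<le> ennreal C * (L (h 0) + L (\<lambda>x. \<Sum>n<k. h (Suc n) x))"
    by (intro norm_triangle) measurable
  also have "\<dots> \<le> ennreal C * (L (h 0) + (\<Sum>n<k. ennreal (C ^ (n + 1)) * L (h (Suc n))))"
    by (intro mult_left_mono add_left_mono Suc.IH) auto
  also have "\<dots> = (\<Sum>n<Suc k. ennreal (C ^ (n + 1)) * L (h n))"
    using concavity_ge_1
    by (subst sum.lessThan_Suc_shift) (simp add: distrib_left sum_distrib_left ennreal_mult mult_ac)
  finally show ?case .
qed

text \<open>The partial sums increase to the full sum, so by the Fatou property their norms converge
  to its norm, and each is bounded by the full weighted series.\<close>

lemma norm_suminf_le:
  assumes [measurable]: "\<And>n. h n \<in> borel_measurable M"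
  shows "L (\<lambda>x. \<Sum>n. h n x) \<le> (\<Sum>n. ennreal (C ^ (n + 1)) * L (h n))"
proof -
  have "(\<lambda>k. L (\<lambda>x. \<Sum>n<k. h n x)) \<longlonglongrightarrow> L (\<lambda>x. \<Sum>n. h n x)"
    by (intro conjunct2[OF norm_Fatou])
      (auto intro!: incseq_SucI summable_LIMSEQ)
  then show ?thesis
  proof (rule LIMSEQ_le_const2)
    have "L (\<lambda>x. \<Sum>n<k. h n x) \<le> (\<Sum>n. ennreal (C ^ (n + 1)) * L (h n))" for k
      using norm_sum_le[OF assms, where k = k]
      by (rule order_trans) (intro sum_le_suminf; simp)
    then show "\<exists>k0. \<forall>k\<ge>k0. L (\<lambda>x. \<Sum>n<k. h n x) \<le> (\<Sum>n. ennreal (C ^ (n + 1)) * L (h n))"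
      by blast
  qed
qed

text \<open>Scaling by 2 fixes \<open>\<infinity> \<cdot> \<chi>\<^sub>E\<close>, so this function has norm \<open>0\<close> as soon as its norm is finite.\<close>

lemma norm_finite_imp_AE_finite:
  assumes [measurable]: "h \<in> borel_measurable M" and fin: "L h < \<infinity>"
  shows "AE x in M. h x \<noteq> \<infinity>"
proof -
  define e where "e x = (if h x = \<infinity> then \<infinity> else 0 :: ennreal)" for x
  have [measurable]: "e \<in> borel_measurable M"
    unfolding e_def[abs_def] by measurable
  have "L e \<le> L h"
    by (intro norm_mono) (auto simp: e_def)
  then have "L e < top"
    using fin by simp
  moreover have "ecomplex_scale 2 (ecomplex_of_ennreal (e x)) = ecomplex_of_ennreal (e x)" for x
    by (simp add: e_def ecomplex_of_ennreal_def)
  \<comment> \<open>The summand \<open>0\<close> puts \<open>L e = 2 * L e\<close> into the shape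
    for left cancellation, which is valid for finite \<open>L e\<close>.\<close>
  then have "L e + 0 = L e + L e"
    using norm_scale[of e 2] by (simp add: mult_2)
  ultimately have "L e = 0"
    unfolding ennreal_add_left_cancel by auto
  then have "AE x in M. e x = 0"
    by (simp add: norm_eq_0_iff)
  then show ?thesis
    by eventually_elim (auto simp: e_def split: if_splits)
qed

lemma function_space_AE_finite:
  assumes "f \<in> function_space M N"
  shows "AE x in M. f x \<noteq> Cinf"
proof -
  have [measurable]: "f \<in> borel_measurable M" and "N f < \<infinity>"
    using assms by (auto simp: function_space_def)
  then have "AE x in M. ecomplex_abs (f x) \<noteq> \<infinity>"
    by (intro norm_finite_imp_AE_finite) (auto simp: norm_abs)
  then show ?thesis
    by simp
qed

text \<open>Comparison through \<open>s k\<close> bounds the norm of the difference by the fixed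
  constant \<open>C\<close> times a sum of two null sequences.\<close>

lemma norm_tendsto_unique:
  assumes s: "\<And>k. s k \<in> borel_measurable M" "\<And>k. AE x in M. s k x \<noteq> Cinf"
    and f: "f \<in> function_space M N" "norm_tendsto N s f"
    and g: "g \<in> function_space M N" "norm_tendsto N s g"
  shows "AE x in M. f x = g x"
proof -
  have [measurable]: "s k \<in> borel_measurable M" "f \<in> borel_measurable M" "g \<in> borel_measurable M" for k
    using s f g by (auto simp: function_space_def)
  let ?d = "\<lambda>x. ecomplex_abs (f x - g x)"
  have fin: "AE x in M. f x \<noteq> Cinf" "AE x in M. g x \<noteq> Cinf"
    using f g by (auto intro: function_space_AE_finite)
  have "L ?d \<le> ennreal C * (N (\<lambda>x. s k x - f x) + N (\<lambda>x. s k x - g x))" for k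
  proof -
    \<comment> \<open>\<open>norm_triangle\<close> speaks of nonnegative functions, so the triangle
      inequality for differences is first taken pointwise.\<close>
    have "L ?d \<le> L (\<lambda>x. ecomplex_abs (s k x - f x) + ecomplex_abs (s k x - g x))"
    proof (intro norm_mono)
      show "AE x in M. ?d x \<le> ecomplex_abs (s k x - f x) + ecomplex_abs (s k x - g x)"
        using s(2)[of k] fin by eventually_elim (rule ecomplex_abs_diff_le)
    qed measurable
    also have "\<dots> \<le> ennreal C *
        (L (\<lambda>x. ecomplex_abs (s k x - f x)) + L (\<lambda>x. ecomplex_abs (s k x - g x)))"
      by (intro norm_triangle) measurable
    finally show ?thesis
      by (simp add: norm_abs)
  qed
  moreover have "(\<lambda>k. ennreal C * (N (\<lambda>x. s k x - f x) + N (\<lambda>x. s k x - g x)))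
      \<longlonglongrightarrow> ennreal C * (0 + 0)"
    using f(2) g(2) unfolding norm_tendsto_def
    by (intro ennreal_tendsto_cmult tendsto_add) auto
  ultimately have "L ?d \<le> ennreal C * (0 + 0)"
    by (intro LIMSEQ_le_const) auto
  then have "AE x in M. ?d x = 0"
    by (subst norm_eq_0_iff[symmetric]) auto
  with fin show ?thesis
  proof eventually_elim
    case (elim x)
    then show ?case
      by (cases "f x"; cases "g x") auto
  qed
qed

section \<open>Pointwise and norm convergence of a fixed series\<close>

context
  fixes f :: "nat \<Rightarrow> 'a \<Rightarrow> ecomplex"
  assumes f: "\<And>n. f n \<in> function_space M N"
    and weighted_sum: "(\<Sum>n. ennreal (C ^ (n + 1)) * N (f n)) < \<infinity>"
begin

text \<open>Finite everywhere by construction. Where the complex series diverges the value is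
  unspecified, which concerns only a null set by \<open>AE_abs_summable\<close>.\<close>

definition pointwise_sum :: "'a \<Rightarrow> ecomplex" where
  "pointwise_sum x = Cfin (\<Sum>n. finite_part (f n x))"

lemma measurable_series [measurable]: "f n \<in> borel_measurable M"
  using f by (auto simp: function_space_def)

lemma measurable_pointwise_sum [measurable]: "pointwise_sum \<in> borel_measurable M"
  unfolding pointwise_sum_def[abs_def] by measurable

lemma AE_abs_summable:
  "AE x in M. (\<forall>n. f n x = Cfin (finite_part (f n x))) \<and> summable (\<lambda>n. cmod (finite_part (f n x)))"
proof -
  have "L (\<lambda>x. \<Sum>n. ecomplex_abs (f n x)) \<le> (\<Sum>n. ennreal (C ^ (n + 1)) * N (f n))"
    using norm_suminf_le[of "\<lambda>n x. ecomplex_abs (f n x)"] by (simp add: norm_abs)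
  then have "L (\<lambda>x. \<Sum>n. ecomplex_abs (f n x)) < \<infinity>"
    using weighted_sum by (rule le_less_trans)
  then have "AE x in M. (\<Sum>n. ecomplex_abs (f n x)) \<noteq> \<infinity>"
    by (intro norm_finite_imp_AE_finite) measurable
  moreover have "AE x in M. \<forall>n. f n x \<noteq> Cinf"
    using f by (simp add: AE_all_countable function_space_AE_finite)
  ultimately show ?thesis
  proof eventually_elim
    case (elim x)
    then have eq: "f n x = Cfin (finite_part (f n x))" for n
      by (simp add: Cfin_finite_part)
    have "ecomplex_abs (f n x) = ennreal (cmod (finite_part (f n x)))" for n
      by (subst eq) simp
    with elim have "summable (\<lambda>n. cmod (finite_part (f n x)))"
      by (intro summable_suminf_not_top) auto
    with eq show ?case
      by blast
  qed
qed

lemma AE_sums_pointwise_sum: "AE x in M. (\<lambda>n. f n x) sums pointwise_sum x"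
  using AE_abs_summable
proof eventually_elim
  case (elim x)
  then have "(\<lambda>n. f n x) = (\<lambda>n. Cfin (finite_part (f n x)))"
    by blast
  moreover have "summable (\<lambda>n. finite_part (f n x))"
    using conjunct2[OF elim] by (rule summable_norm_cancel)
  then have "(\<lambda>n. Cfin (finite_part (f n x))) sums pointwise_sum x"
    unfolding pointwise_sum_def by (rule sums_Cfin[OF summable_sums])
  ultimately show ?case
    by metis
qed

text \<open>Up to sign the remainder is the tail of an absolutely convergent series, so the series
  of the moduli dominates it.\<close>

lemma AE_abs_tail_le:
  "AE x in M. ecomplex_abs ((\<Sum>n<k. f n x) - pointwise_sum x) \<le> (\<Sum>n. ecomplex_abs (f (n + k) x))"
  using AE_abs_summable
proof eventually_elim
  case (elim x)
  define z where "z n = finite_part (f n x)" for n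
  have fz: "f n x = Cfin (z n)" for n
    unfolding z_def using elim by blast
  have sz: "summable (\<lambda>n. cmod (z n))"
    unfolding z_def using elim by blast
  then have abs: "summable (\<lambda>n. cmod (z (n + k)))"
    by (rule summable_ignore_initial_segment)
  from sz have "summable z"
    by (rule summable_norm_cancel)
  then have "(\<Sum>n. z n) = (\<Sum>n. z (n + k)) + (\<Sum>n<k. z n)"
    by (rule suminf_split_initial_segment)
  then have "cmod ((\<Sum>n<k. z n) - (\<Sum>n. z n)) = cmod (\<Sum>n. z (n + k))"
    by simp
  also have "\<dots> \<le> (\<Sum>n. cmod (z (n + k)))"
    using abs by (rule summable_norm)
  finally have "ennreal (cmod ((\<Sum>n<k. z n) - (\<Sum>n. z n))) \<le> (\<Sum>n. ennreal (cmod (z (n + k))))"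
    using abs by (subst suminf_ennreal2) (auto intro: ennreal_leI)
  then show ?case
    by (simp add: pointwise_sum_def fz sum_Cfin)
qed

lemma norm_tail_le:
  "N (\<lambda>x. (\<Sum>n<k. f n x) - pointwise_sum x) \<le> (\<Sum>n. ennreal (C ^ (n + k + 1)) * N (f (n + k)))"
proof -
  have "N (\<lambda>x. (\<Sum>n<k. f n x) - pointwise_sum x) =
      L (\<lambda>x. ecomplex_abs ((\<Sum>n<k. f n x) - pointwise_sum x))"
    by (simp add: norm_abs)
  also have "\<dots> \<le> L (\<lambda>x. \<Sum>n. ecomplex_abs (f (n + k) x))"
    by (intro norm_mono AE_abs_tail_le) measurable
  also have "\<dots> \<le> (\<Sum>n. ennreal (C ^ (n + 1)) * N (f (n + k)))"
    using norm_suminf_le[of "\<lambda>n x. ecomplex_abs (f (n + k) x)"] by (simp add: norm_abs)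
  \<comment> \<open>Since \<open>C\<close> is at least 1, the weights may be raised; the bound then
    becomes a tail of the weighted series assumed to be finite.\<close>
  also have "\<dots> \<le> (\<Sum>n. ennreal (C ^ (n + k + 1)) * N (f (n + k)))"
    using concavity_ge_1
    by (intro suminf_le mult_right_mono ennreal_leI power_increasing) auto
  finally show ?thesis .
qed

lemma pointwise_sum_in_function_space: "pointwise_sum \<in> function_space M N"
proof -
  have "ecomplex_abs (0 - z) = ecomplex_abs z" for z
    by (cases z) (simp_all add: zero_ecomplex_def)
  \<comment> \<open>The right-hand side is the remainder after the empty partial sum, so the tail
    estimate at \<open>k = 0\<close> applies.\<close>
  then have "N pointwise_sum = N (\<lambda>x. 0 - pointwise_sum x)"
    using norm_abs[of pointwise_sum] norm_abs[of "\<lambda>x. 0 - pointwise_sum x"] by simp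
  also have "\<dots> < \<infinity>"
    using norm_tail_le[of 0] weighted_sum by simp
  finally show ?thesis
    by (simp add: function_space_def)
qed

lemma norm_tendsto_pointwise_sum: "norm_tendsto N (\<lambda>k x. \<Sum>n\<le>k. f n x) pointwise_sum"
proof -
  have "(\<lambda>k. N (\<lambda>x. (\<Sum>n<k. f n x) - pointwise_sum x)) \<longlonglongrightarrow> 0"
    using tendsto_const tendsto_suminf_tail_ennreal[OF weighted_sum]
    by (rule tendsto_sandwich[rotated 2]) (use norm_tail_le in auto)
  \<comment> \<open>The index shift turns sums over \<open>n < k\<close> into sums over
    \<open>n \<le> k\<close>.\<close>
  from LIMSEQ_Suc[OF this] show ?thesis
    by (simp only: norm_tendsto_def lessThan_Suc_atMost)
qed

text \<open>Here \<open>g\<close> is any norm limit. Uniqueness identifies it almost everywhere with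
  \<open>pointwise_sum\<close>, to which the series is known to converge pointwise.\<close>

lemma AE_sums_norm_limit:
  assumes "g \<in> function_space M N" "norm_tendsto N (\<lambda>k x. \<Sum>n\<le>k. f n x) g"
  shows "AE x in M. (\<lambda>n. f n x) sums g x"
proof -
  have "AE x in M. (\<Sum>n\<le>k. f n x) \<noteq> Cinf" for k
    using AE_abs_summable
  proof eventually_elim
    case (elim x)
    then have "(\<Sum>n\<le>k. f n x) = Cfin (\<Sum>n\<le>k. finite_part (f n x))"
      by (simp flip: sum_Cfin)
    then show ?case
      by simp
  qed
  then have "AE x in M. pointwise_sum x = g x"
    using assms pointwise_sum_in_function_space norm_tendsto_pointwise_sum
    by (intro norm_tendsto_unique[of "\<lambda>k x. \<Sum>n\<le>k. f n x"]) auto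
  with AE_sums_pointwise_sum show ?thesis
    by eventually_elim simp
qed

end

end

theorem theorem3p7:
  fixes M :: "'a measure" and N :: "('a \<Rightarrow> ecomplex) \<Rightarrow> ennreal" and C :: real
  assumes "quasi_banach_function_norm M N C"
  shows "generalised_riesz_fischer M N C \<and>
    (\<forall>(f :: nat \<Rightarrow> 'a \<Rightarrow> ecomplex) g.
      (\<forall>n. f n \<in> function_space M N) \<longrightarrow>
      (\<Sum>n. ennreal (C ^ (n + 1)) * N (f n)) < \<infinity> \<longrightarrow>
      g \<in> function_space M N \<longrightarrow>
      norm_tendsto N (\<lambda>k x. \<Sum>n\<le>k. f n x) g \<longrightarrow>
      (AE x in M. (\<lambda>n. f n x) sums g x))"
proof -
  interpret quasi_banach_function_norm M N C
    by fact
  show ?thesis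
    unfolding generalised_riesz_fischer_def
  proof (intro conjI allI impI)
    fix f :: "nat \<Rightarrow> 'a \<Rightarrow> ecomplex"
    assume f: "(\<forall>n. f n \<in> function_space M N) \<and> (\<Sum>n. ennreal (C ^ (n + 1)) * N (f n)) < \<infinity>"
    show "\<exists>g \<in> function_space M N. norm_tendsto N (\<lambda>k x. \<Sum>n\<le>k. f n x) g"
      using norm_tendsto_pointwise_sum[OF spec[OF conjunct1[OF f]] conjunct2[OF f]]
        pointwise_sum_in_function_space[OF spec[OF conjunct1[OF f]] conjunct2[OF f]]
      by (rule bexI)
  next
    fix f :: "nat \<Rightarrow> 'a \<Rightarrow> ecomplex" and g
    assume f: "\<forall>n. f n \<in> function_space M N" "(\<Sum>n. ennreal (C ^ (n + 1)) * N (f n)) < \<infinity>"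
      and g: "g \<in> function_space M N" "norm_tendsto N (\<lambda>k x. \<Sum>n\<le>k. f n x) g"
    show "AE x in M. (\<lambda>n. f n x) sums g x"
      by (rule AE_sums_norm_limit[OF spec[OF f(1)] f(2) g])
  qed
qed

end
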